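(* There are only finitely many antipodal distance-regular graphs $X$ of diameter three such that the linear span of $\{I,A_1,A_2,A_3\}$ contains a complex Hadamard matrix, where $A_i$ is the $i$-th distance matrix of $X$.
   Context: A graph of diameter $d$ is antipodal if the relation "at distance $0$ or $d$" is an equivalence relation. The $i$-th distance matrix $A_i$ of a graph has $(u,w)$-entry $1$ if $u,w$ are at distance $i$ and $0$ otherwise. An $N\times N$ complex matrix $W$ is a complex Hadamard matrix if every entry has absolute value $1$ and $W\overline{W}^T=NI$. *)

theory Defs
  imports
    "Graph_Theory.Graph_Theory"
    "Jordan_Normal_Form.Matrix"
begin

text \<open>
  Finite simple graphs are the symmetric digraphs of the locale \<^locale>\<open>graph\<close> (finite, loopless,
  no parallel arcs).  The graph distance is the shortest-path distance for unit arc weights; it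
  takes values in the extended reals and is infinite between different components.
\<close>

definition graph_dist :: "('a, 'b) pre_digraph \<Rightarrow> 'a \<Rightarrow> 'a \<Rightarrow> ereal" where
  "graph_dist X u v = wf_digraph.\<mu> X (\<lambda>_. 1) u v"

definition graph_diameter :: "('a, 'b) pre_digraph \<Rightarrow> ereal" where
  "graph_diameter X = (SUP u\<in>verts X. SUP v\<in>verts X. graph_dist X u v)"

text \<open>
  The number of vertices at distance i from u and at distance j from v depends only on i, j and
  the distance between u and v.
\<close>

definition distance_regular :: "('a, 'b) pre_digraph \<Rightarrow> bool" where
  "distance_regular X \<longleftrightarrow>
     graph X \<and> Digraph_Component.connected X \<and>
     (\<forall>u\<in>verts X. \<forall>v\<in>verts X. \<forall>u'\<in>verts X. \<forall>v'\<in>verts X.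
        graph_dist X u v = graph_dist X u' v' \<longrightarrow>
        (\<forall>i j :: nat.
           card {w \<in> verts X. graph_dist X u w = ereal (real i) \<and> graph_dist X v w = ereal (real j)} =
           card {w \<in> verts X. graph_dist X u' w = ereal (real i) \<and> graph_dist X v' w = ereal (real j)}))"

definition antipodal :: "('a, 'b) pre_digraph \<Rightarrow> bool" where
  "antipodal X \<longleftrightarrow>
     equiv (verts X) {(u, v). u \<in> verts X \<and> v \<in> verts X \<and>
       (graph_dist X u v = 0 \<or> graph_dist X u v = graph_diameter X)}"

text \<open>
  Matrices have rows and columns indexed by initial segments of the natural numbers, so distance
  matrices are taken with respect to a list enumerating the vertices.
\<close>

definition vertex_enumeration :: "('a, 'b) pre_digraph \<Rightarrow> 'a list \<Rightarrow> bool" where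
  "vertex_enumeration X vs \<longleftrightarrow> distinct vs \<and> set vs = verts X"

definition distance_matrix :: "('a, 'b) pre_digraph \<Rightarrow> 'a list \<Rightarrow> nat \<Rightarrow> complex mat" where
  "distance_matrix X vs i =
     mat (length vs) (length vs)
       (\<lambda>(k, l). if graph_dist X (vs ! k) (vs ! l) = ereal (real i) then 1 else 0)"

definition distance_span3 :: "('a, 'b) pre_digraph \<Rightarrow> 'a list \<Rightarrow> complex mat set" where
  "distance_span3 X vs =
     {a \<cdot>\<^sub>m 1\<^sub>m (length vs) + b \<cdot>\<^sub>m distance_matrix X vs 1
        + c \<cdot>\<^sub>m distance_matrix X vs 2 + d \<cdot>\<^sub>m distance_matrix X vs 3 | a b c d. True}"

definition complex_hadamard :: "nat \<Rightarrow> complex mat \<Rightarrow> bool" where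
  "complex_hadamard N W \<longleftrightarrow>
     W \<in> carrier_mat N N \<and>
     (\<forall>i<N. \<forall>j<N. cmod (W $$ (i, j)) = 1) \<and>
     W * transpose_mat (map_mat cnj W) = of_nat N \<cdot>\<^sub>m 1\<^sub>m N"

text \<open>
  Renumbering the vertices conjugates all distance matrices by one permutation matrix, so the
  following property does not depend on the enumeration.
\<close>

definition span_contains_hadamard :: "('a, 'b) pre_digraph \<Rightarrow> bool" where
  "span_contains_hadamard X \<longleftrightarrow>
     (\<exists>vs. vertex_enumeration X vs \<and>
       (\<exists>W \<in> distance_span3 X vs. complex_hadamard (card (verts X)) W))"

end

theory Submission
  imports Defs
begin

text \<open>
  The antipodal classes (fibres) of \<open>X\<close> have a common size \<open>r\<close>, and a vertex outside a fibre has
  exactly one neighbour in it, so a \<open>k\<close>-regular \<open>X\<close> has \<open>N = r (1 + k)\<close> vertices.  The rows of a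
  Hadamard matrix \<open>W\<close> in the span are orthogonal of squared norm \<open>N\<close> and have unimodular entries.
  The rows of two vertices at distance 3 agree outside these vertices and their neighbours, so the
  squared norm \<open>2 N\<close> of their difference is at most \<open>4 (2 + 2 k)\<close>; hence \<open>r \<le> 4\<close>.  Every entry of
  the sum of the rows in a fibre is at most \<open>r\<close> in absolute value, and two such row sums agree
  outside their fibres, so the squared norm \<open>2 r N\<close> of their difference is at most
  \<open>2 r (2 r)\<^sup>2\<close>; hence \<open>N \<le> 4 r\<^sup>2 \<le> 64\<close>.
\<close>

section \<open>Fibres of an antipodal distance-regular scheme of diameter three\<close>

text \<open>Only natural-number distances remain here: \<open>dist_step\<close> makes them path
  lengths in the graph of pairs at distance 1, and \<open>dist_3_trans\<close> is antipodality, with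
  \<open>u = w\<close> set apart because that case falls under distance 0.\<close>

locale antipodal_scheme =
  fixes V :: "'a set" and d :: "'a \<Rightarrow> 'a \<Rightarrow> nat"
  assumes finite_V: "finite V"
    and dist_le_3: "\<lbrakk>u \<in> V; v \<in> V\<rbrakk> \<Longrightarrow> d u v \<le> 3"
    and dist_0_iff: "\<lbrakk>u \<in> V; v \<in> V\<rbrakk> \<Longrightarrow> d u v = 0 \<longleftrightarrow> u = v"
    and dist_sym: "\<lbrakk>u \<in> V; v \<in> V\<rbrakk> \<Longrightarrow> d u v = d v u"
    and dist_triangle: "\<lbrakk>u \<in> V; v \<in> V; w \<in> V\<rbrakk> \<Longrightarrow> d u w \<le> d u v + d v w"
    and dist_step: "\<lbrakk>u \<in> V; v \<in> V; d u v = Suc n\<rbrakk> \<Longrightarrow> \<exists>w\<in>V. d u w = 1 \<and> d w v = n"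
    and dist_3_trans:
      "\<lbrakk>u \<in> V; v \<in> V; w \<in> V; d u v = 3; d v w = 3; u \<noteq> w\<rbrakk> \<Longrightarrow> d u w = 3"
    and regular:
      "\<lbrakk>u \<in> V; v \<in> V; u' \<in> V; v' \<in> V; d u v = d u' v'\<rbrakk> \<Longrightarrow>
        card {w \<in> V. d u w = i \<and> d v w = j} = card {w \<in> V. d u' w = i \<and> d v' w = j}"
    and ex_dist_3: "\<exists>u\<in>V. \<exists>v\<in>V. d u v = 3"
begin

definition fibre :: "'a \<Rightarrow> 'a set" where
  "fibre u = {v \<in> V. d u v = 0 \<or> d u v = 3}"

definition neighbours :: "'a \<Rightarrow> 'a set" where
  "neighbours u = {v \<in> V. d u v = 1}"

lemma dist_refl [simp]: "u \<in> V \<Longrightarrow> d u u = 0"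
  by (simp add: dist_0_iff)

lemma fibre_subset: "fibre u \<subseteq> V"
  by (auto simp: fibre_def)

lemma finite_fibre [simp]: "finite (fibre u)"
  using finite_V fibre_subset finite_subset by blast

lemma finite_neighbours [simp]: "finite (neighbours u)"
  using finite_V by (auto simp: neighbours_def)

text \<open>The auxiliary claim compares two members of a fibre through its base point; equal
  members, which \<open>dist_3_trans\<close> leaves out, are at distance 0. Both inclusions are
  instances of this claim.\<close>

lemma fibre_cong:
  assumes "u \<in> V" "v \<in> fibre u"
  shows "fibre v = fibre u"
proof -
  have v: "v \<in> V" using assms fibre_subset by auto
  have *: "w \<in> fibre b" if "b \<in> fibre a" "w \<in> fibre a" "a \<in> V" for a b w
  proof -
    have V: "b \<in> V" "w \<in> V" using that fibre_subset by auto
    have "a = b \<or> d b a = 3" "a = w \<or> d a w = 3"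
      using that V by (auto simp: fibre_def dist_0_iff dist_sym)
    then show ?thesis
      using that(3) V dist_3_trans[of b a w] dist_0_iff[of b w] by (auto simp: fibre_def)
  qed
  have "u \<in> fibre v" "v \<in> fibre v" "u \<in> fibre u"
    using assms v by (auto simp: fibre_def dist_sym)
  then show ?thesis
    by (intro equalityI subsetI) (rule *[of v u] *[of u v], use assms v in simp_all)+
qed

text \<open>All pairs \<open>(u, u)\<close> have distance 0, so regularity applied to them makes the
  number of vertices at distance 3 constant; the base point adds one.\<close>

lemma card_fibre:
  assumes "u \<in> V" "v \<in> V"
  shows "card (fibre u) = card (fibre v)"
proof -
  have *: "card (fibre w) = Suc (card {x \<in> V. d w x = 3 \<and> d w x = 3})" if "w \<in> V" for w
  proof -
    have "fibre w = insert w {x \<in> V. d w x = 3 \<and> d w x = 3}"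
      using that by (auto simp: fibre_def dist_0_iff)
    moreover have "w \<notin> {x \<in> V. d w x = 3 \<and> d w x = 3}"
      using that by auto
    ultimately show ?thesis using finite_V by simp
  qed
  show ?thesis
    using assms * regular[of u u v v 3 3] by simp
qed

lemma card_neighbours:
  assumes "u \<in> V" "v \<in> V"
  shows "card (neighbours u) = card (neighbours v)"
  using assms regular[of u u v v 1 1]
  by (simp add: neighbours_def)

text \<open>If \<open>u\<close> itself is not the neighbour, then \<open>d u w = 2\<close>. The
  first step \<open>c\<close> of a shortest path from \<open>a\<close> to \<open>b\<close> of length
  3 gives a pair \<open>b\<close>, \<open>c\<close> at distance 2 such that \<open>a\<close> is at
  distance 3 from \<open>b\<close> and adjacent to \<open>c\<close>. Regularity carries this
  positive count over to \<open>u\<close>, \<open>w\<close>.\<close>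

lemma ex_neighbour_in_fibre:
  assumes "u \<in> V" "w \<in> V" "w \<notin> fibre u"
  shows "\<exists>v\<in>fibre u. d w v = 1"
proof (cases "d u w = 1")
  case True
  then show ?thesis using assms dist_sym[of u w] by (auto simp: fibre_def)
next
  case False
  then have 2: "d u w = 2" using assms dist_le_3[of u w] by (auto simp: fibre_def)
  obtain a b where ab: "a \<in> V" "b \<in> V" "d a b = 3" using ex_dist_3 by auto
  obtain c where c: "c \<in> V" "d a c = 1" "d c b = 2"
    using dist_step[of a b 2] ab by auto
  have "a \<in> {x \<in> V. d b x = 3 \<and> d c x = 1}" using ab c dist_sym by auto
  then have "card {x \<in> V. d b x = 3 \<and> d c x = 1} \<noteq> 0" using finite_V by auto
  moreover have "d b c = d u w" using 2 c ab dist_sym[of b c] by simp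
  ultimately have "card {x \<in> V. d u x = 3 \<and> d w x = 1} \<noteq> 0"
    using regular[of b c u w 3 1] assms ab c by simp
  then have "{x \<in> V. d u x = 3 \<and> d w x = 1} \<noteq> {}" by (metis card.empty)
  then show ?thesis by (auto simp: fibre_def)
qed

text \<open>Two neighbours of \<open>w\<close> are at distance at most 2, whereas distinct members
  of a fibre are at distance 3.\<close>

lemma ex1_neighbour_in_fibre:
  assumes "u \<in> V" "w \<in> V" "w \<notin> fibre u"
  shows "\<exists>!v. v \<in> fibre u \<and> d w v = 1"
proof -
  have "v = v'" if "v \<in> fibre u" "d w v = 1" "v' \<in> fibre u" "d w v' = 1" for v v'
  proof (rule ccontr)
    assume "v \<noteq> v'"
    have V: "v \<in> V" "v' \<in> V" using that fibre_subset by auto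
    have "v' \<in> fibre v" using fibre_cong[of u v] assms that by auto
    then have "d v v' = 3" using \<open>v \<noteq> v'\<close> V dist_0_iff[of v v'] by (auto simp: fibre_def)
    with dist_triangle[of v w v'] dist_sym[of v w] that V assms show False by auto
  qed
  with ex_neighbour_in_fibre[OF assms] show ?thesis by blast
qed

lemma dist_outside_fibre:
  assumes "u \<in> V" "w \<in> V" "w \<notin> fibre u" "v \<in> fibre u"
  shows "d v w = 1 \<or> d v w = 2"
proof -
  have "v \<in> V" "w \<notin> fibre v" using assms fibre_subset fibre_cong[OF assms(1,4)] by auto
  then show ?thesis using assms dist_le_3[of v w] by (auto simp: fibre_def)
qed

text \<open>One member of the fibre is adjacent to \<open>w\<close> and the others are at distance
  2. The value depends neither on \<open>w\<close> nor, fibres having equal size, on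
  \<open>u\<close>; this makes the row sums of two fibres cancel outside both.\<close>

lemma sum_fibre_outside:
  fixes f :: "nat \<Rightarrow> 'b :: comm_ring_1"
  assumes "u \<in> V" "w \<in> V" "w \<notin> fibre u"
  shows "(\<Sum>v\<in>fibre u. f (d v w)) = f 1 + of_nat (card (fibre u) - 1) * f 2"
proof -
  obtain x where x: "x \<in> fibre u" "d w x = 1"
    and uniq: "\<And>v. v \<in> fibre u \<Longrightarrow> d w v = 1 \<Longrightarrow> v = x"
    using ex1_neighbour_in_fibre[OF assms] by blast
  have V: "v \<in> V" if "v \<in> fibre u" for v using that fibre_subset by auto
  have "(\<Sum>v\<in>fibre u. f (d v w)) = f (d x w) + (\<Sum>v\<in>fibre u - {x}. f (d v w))"
    using x by (simp add: sum.remove)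
  also have "(\<Sum>v\<in>fibre u - {x}. f (d v w)) = (\<Sum>v\<in>fibre u - {x}. f 2)"
  proof (rule sum.cong)
    fix v assume v: "v \<in> fibre u - {x}"
    then have "d v w = 2"
      using dist_outside_fibre[OF assms, of v] uniq[of v] dist_sym[of v w] V assms by auto
    then show "f (d v w) = f 2" by simp
  qed simp
  finally show ?thesis using x V assms dist_sym[of x w] by (simp add: card_Diff_singleton)
qed

text \<open>Double counting of the edges that leave a fibre of size r: all k edges at each of its
  vertices go outside, and each of the N - r outside vertices receives exactly one, so r k = N -
  r.\<close>

lemma card_V:
  assumes "u \<in> V"
  shows "card V = card (fibre u) * (1 + card (neighbours u))"
proof -
  have "card (fibre u) * card (neighbours u) = (\<Sum>v\<in>fibre u. card (neighbours v))"
  proof -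
    have "card (neighbours v) = card (neighbours u)" if "v \<in> fibre u" for v
      using that assms fibre_subset by (intro card_neighbours) auto
    then show ?thesis by simp
  qed
  also have "\<dots> = (\<Sum>v\<in>fibre u. \<Sum>w\<in>V. if d w v = 1 then 1 else 0)"
  proof (rule sum.cong)
    fix v assume "v \<in> fibre u"
    then have "v \<in> V" using fibre_subset by auto
    then have "neighbours v = {w \<in> V. d w v = 1}"
      using dist_sym[of v] by (auto simp: neighbours_def)
    then show "card (neighbours v) = (\<Sum>w\<in>V. if d w v = 1 then 1 else 0)"
      using finite_V by (simp add: sum.If_cases Int_def)
  qed simp
  also have "\<dots> = (\<Sum>w\<in>V. card {v \<in> fibre u. d w v = 1})"
    by (subst sum.swap) (simp add: sum.If_cases Int_def)
  also have "\<dots> = (\<Sum>w\<in>V - fibre u. 1)"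
  proof (rule sum.mono_neutral_cong_right)
    show "\<forall>w\<in>V - (V - fibre u). card {v \<in> fibre u. d w v = 1} = 0"
    proof
      fix w assume "w \<in> V - (V - fibre u)"
      then have "fibre w = fibre u" by (intro fibre_cong assms) auto
      moreover have "{v \<in> fibre w. d w v = 1} = {}" by (auto simp: fibre_def)
      ultimately show "card {v \<in> fibre u. d w v = 1} = 0" by simp
    qed
    fix w assume "w \<in> V - fibre u"
    then obtain x where "x \<in> fibre u" "d w x = 1" "\<And>v. v \<in> fibre u \<Longrightarrow> d w v = 1 \<Longrightarrow> v = x"
      using ex1_neighbour_in_fibre[of u w] assms by blast
    then have "{v \<in> fibre u. d w v = 1} = {x}" by blast
    then show "card {v \<in> fibre u. d w v = 1} = 1" by simp
  qed (use finite_V in auto)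
  also have "\<dots> = card V - card (fibre u)"
    using finite_V fibre_subset by (simp add: card_Diff_subset)
  finally show ?thesis
    using card_mono[OF finite_V fibre_subset[of u]] by simp
qed

end

section \<open>Size bounds from a Hadamard matrix\<close>

locale hadamard_scheme = antipodal_scheme V d
  for V :: "'a set" and d :: "'a \<Rightarrow> 'a \<Rightarrow> nat" +
  fixes f :: "nat \<Rightarrow> complex"
  assumes unimodular: "\<lbrakk>u \<in> V; v \<in> V\<rbrakk> \<Longrightarrow> cmod (f (d u v)) = 1"
    and orthogonal: "\<lbrakk>u \<in> V; v \<in> V\<rbrakk> \<Longrightarrow>
      (\<Sum>w\<in>V. f (d u w) * cnj (f (d v w))) = (if u = v then of_nat (card V) else 0)"
begin

text \<open>With \<open>f (d v w)\<close> read as the matrix entry in row \<open>v\<close> and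
  column \<open>w\<close>, this is the squared norm of a combination of orthogonal rows of squared
  norm \<open>card V\<close>.\<close>

lemma parseval:
  "(\<Sum>w\<in>V. (cmod (\<Sum>v\<in>V. g v * f (d v w)))\<^sup>2) = card V * (\<Sum>v\<in>V. (cmod (g v))\<^sup>2)"
proof -
  have "complex_of_real (\<Sum>w\<in>V. (cmod (\<Sum>v\<in>V. g v * f (d v w)))\<^sup>2)
      = (\<Sum>w\<in>V. (\<Sum>v\<in>V. g v * f (d v w)) * cnj (\<Sum>v\<in>V. g v * f (d v w)))"
    by (simp only: of_real_sum complex_norm_square)
  also have "\<dots> = (\<Sum>w\<in>V. \<Sum>u\<in>V. \<Sum>v\<in>V. g u * cnj (g v) * (f (d u w) * cnj (f (d v w))))"
    by (simp add: sum_product cnj_sum mult.assoc mult.left_commute)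
  also have "\<dots> = (\<Sum>u\<in>V. \<Sum>v\<in>V. g u * cnj (g v) * (\<Sum>w\<in>V. f (d u w) * cnj (f (d v w))))"
    by (subst sum.swap, rule sum.cong[OF refl], subst sum.swap) (simp add: sum_distrib_left)
  also have "\<dots> = (\<Sum>u\<in>V. \<Sum>v\<in>V. if u = v then g u * cnj (g v) * of_nat (card V) else 0)"
    by (intro sum.cong refl) (simp add: orthogonal)
  also have "\<dots> = (\<Sum>u\<in>V. of_nat (card V) * (g u * cnj (g u)))"
    using finite_V by (simp add: sum.delta mult_ac)
  also have "\<dots> = complex_of_real (card V * (\<Sum>v\<in>V. (cmod (g v))\<^sup>2))"
    by (simp only: of_real_mult of_real_sum of_real_of_nat_eq complex_norm_square sum_distrib_left)
  finally show ?thesis by (simp only: of_real_eq_iff)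
qed

lemma card_V_le_fibre:
  assumes "u \<in> V"
  shows "card V \<le> 4 * (card (fibre u))\<^sup>2"
proof -
  obtain a b where ab: "a \<in> V" "b \<in> V" "d a b = 3" using ex_dist_3 by auto
  \<comment> \<open>A neighbour of \<open>a\<close> is neither \<open>a\<close> nor at distance 3
    from it, so its fibre is a second one.\<close>
  then obtain x where x: "x \<in> V" "d a x = 1" using dist_step[of a b 2] by auto
  let ?A = "fibre a" and ?B = "fibre x"
  define r where "r = card ?A"
  have disj: "?A \<inter> ?B = {}"
  proof (rule ccontr)
    assume "?A \<inter> ?B \<noteq> {}"
    then have "?A = ?B" using fibre_cong ab x by blast
    moreover have "x \<in> ?B" using x by (auto simp: fibre_def)
    ultimately have "x \<in> ?A" by simp
    then show False using x by (auto simp: fibre_def)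
  qed
  have r: "card ?B = r" "card (fibre u) = r"
    unfolding r_def using card_fibre ab x assms by metis+
  \<comment> \<open>These coefficients produce the difference of the row sums of the two
    fibres.\<close>
  define g :: "'a \<Rightarrow> complex" where "g v = (if v \<in> ?A then 1 else 0) - (if v \<in> ?B then 1 else 0)" for v
  have AB: "?A \<subseteq> V" "?B \<subseteq> V" using fibre_subset by auto
  have h: "(\<Sum>v\<in>V. g v * f (d v w)) = (\<Sum>v\<in>?A. f (d v w)) - (\<Sum>v\<in>?B. f (d v w))" for w
    using AB finite_V
    by (simp add: g_def left_diff_distrib sum_subtractf if_distrib[of "\<lambda>c. c * _"]
        sum.If_cases Int_absorb1 cong: if_cong)
  have cardAB: "card (?A \<union> ?B) = 2 * r"
    using disj r by (simp add: card_Un_disjoint r_def)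
  have "(\<Sum>v\<in>V. (cmod (g v))\<^sup>2) = (\<Sum>v\<in>?A \<union> ?B. 1)"
    using AB finite_V disj by (intro sum.mono_neutral_cong_right) (auto simp: g_def)
  then have "card V * real (2 * r) = (\<Sum>w\<in>V. (cmod (\<Sum>v\<in>V. g v * f (d v w)))\<^sup>2)"
    using parseval[of g] cardAB by simp
  also have "\<dots> = (\<Sum>w\<in>?A \<union> ?B. (cmod (\<Sum>v\<in>V. g v * f (d v w)))\<^sup>2)"
  proof (rule sum.mono_neutral_right)
    \<comment> \<open>Outside both fibres each row sum equals
      \<open>f 1 + (r - 1) * f 2\<close>.\<close>
    show "\<forall>w\<in>V - (?A \<union> ?B). (cmod (\<Sum>v\<in>V. g v * f (d v w)))\<^sup>2 = 0"
      using ab x r by (auto simp: h sum_fibre_outside r_def)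
  qed (use AB finite_V in auto)
  \<comment> \<open>On the remaining columns each row sum has \<open>r\<close> unimodular
    terms.\<close>
  also have "\<dots> \<le> (\<Sum>w\<in>?A \<union> ?B. (2 * real r)\<^sup>2)"
  proof (intro sum_mono power_mono)
    fix w assume "w \<in> ?A \<union> ?B"
    then have w: "w \<in> V" using AB by auto
    have "cmod (\<Sum>v\<in>S. f (d v w)) \<le> real (card S)" if "S \<subseteq> V" for S
      using sum_norm_bound[of S "\<lambda>v. f (d v w)" 1] unimodular that w by (auto simp: subset_iff)
    from this[OF AB(1)] this[OF AB(2)]
    show "cmod (\<Sum>v\<in>V. g v * f (d v w)) \<le> 2 * real r"
      unfolding h r using norm_triangle_ineq4[of "\<Sum>v\<in>?A. f (d v w)" "\<Sum>v\<in>?B. f (d v w)"]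
      by (simp add: r_def r)
  qed simp
  also have "\<dots> = (4 * real r ^ 2) * real (2 * r)"
    by (simp add: cardAB power2_eq_square)
  finally have *: "card V * real (2 * r) \<le> (4 * real r ^ 2) * real (2 * r)" .
  \<comment> \<open>Positivity of \<open>r\<close> allows the common factor \<open>2 * r\<close> to
    be cancelled.\<close>
  have "a \<in> ?A" using ab by (auto simp: fibre_def)
  then have "0 < r" unfolding r_def by (metis card_gt_0_iff empty_iff finite_fibre)
  then have "real (card V) \<le> real (4 * r ^ 2)" using * by (simp add: mult_le_cancel_right)
  then show ?thesis unfolding r by (simp only: of_nat_le_iff)
qed

lemma card_V_le_neighbours:
  assumes "u \<in> V"
  shows "card V \<le> 4 * (1 + card (neighbours u))"
proof -
  obtain a b where ab: "a \<in> V" "b \<in> V" "d a b = 3" using ex_dist_3 by auto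
  then have "a \<noteq> b" using dist_0_iff[of a b] by auto
  define g :: "'a \<Rightarrow> complex" where "g v = (if v = a then 1 else 0) - (if v = b then 1 else 0)" for v
  have h: "(\<Sum>v\<in>V. g v * f (d v w)) = f (d a w) - f (d b w)" for w
    using ab finite_V
    by (simp add: g_def left_diff_distrib sum_subtractf if_distrib[of "\<lambda>c. c * _"]
        sum.delta sum.delta' cong: if_cong)
  \<comment> \<open>Outside \<open>?S\<close> the rows of \<open>a\<close> and \<open>b\<close>
    agree: a vertex of their common fibre is at distance 3 from both, and any other vertex is at
    distance 2 from both.\<close>
  let ?S = "{a, b} \<union> neighbours a \<union> neighbours b"
  have S: "?S \<subseteq> V" using ab by (auto simp: neighbours_def)
  have "(\<Sum>v\<in>V. (cmod (g v))\<^sup>2) = (\<Sum>v\<in>{a, b}. 1)"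
    using ab finite_V \<open>a \<noteq> b\<close> by (intro sum.mono_neutral_cong_right) (auto simp: g_def)
  then have "card V * 2 = (\<Sum>w\<in>V. (cmod (f (d a w) - f (d b w)))\<^sup>2)"
    using parseval[of g] h \<open>a \<noteq> b\<close> by simp
  also have "\<dots> = (\<Sum>w\<in>?S. (cmod (f (d a w) - f (d b w)))\<^sup>2)"
  proof (rule sum.mono_neutral_right)
    show "\<forall>w\<in>V - ?S. (cmod (f (d a w) - f (d b w)))\<^sup>2 = 0"
    proof
      fix w assume w: "w \<in> V - ?S"
      have "b \<in> fibre a" using ab by (auto simp: fibre_def)
      then have "fibre b = fibre a" by (intro fibre_cong ab)
      then have "w \<in> fibre a \<longleftrightarrow> w \<in> fibre b" by simp
      then have "d a w = d b w"
        using w ab dist_0_iff[of a w] dist_0_iff[of b w] dist_le_3[of a w] dist_le_3[of b w]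
        by (auto simp: fibre_def neighbours_def)
      then show "(cmod (f (d a w) - f (d b w)))\<^sup>2 = 0" by simp
    qed
  qed (use S finite_V in auto)
  also have "\<dots> \<le> (\<Sum>w\<in>?S. 2\<^sup>2)"
  proof (intro sum_mono power_mono)
    fix w assume "w \<in> ?S"
    then have "w \<in> V" using S by auto
    then show "cmod (f (d a w) - f (d b w)) \<le> 2"
      using norm_triangle_ineq4[of "f (d a w)" "f (d b w)"] unimodular ab by simp
  qed simp
  finally have "real (card V * 2) \<le> real (card ?S * 4)" by simp
  then have "card V * 2 \<le> card ?S * 4" by (simp only: of_nat_le_iff)
  also have "card ?S \<le> card {a, b} + card (neighbours a) + card (neighbours b)"
    using card_Un_le[of "{a, b} \<union> neighbours a" "neighbours b"]
      card_Un_le[of "{a, b}" "neighbours a"] by linarith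
  also have "\<dots> = 2 * (1 + card (neighbours u))"
    using card_neighbours[OF ab(1) assms] card_neighbours[OF ab(2) assms] \<open>a \<noteq> b\<close> by simp
  finally show ?thesis by simp
qed

theorem card_V_le_64: "card V \<le> 64"
proof -
  obtain u where u: "u \<in> V" using ex_dist_3 by auto
  have "card (fibre u) * (1 + card (neighbours u)) \<le> 4 * (1 + card (neighbours u))"
    using card_V_le_neighbours[OF u] card_V[OF u] by simp
  \<comment> \<open>The cancelled factor \<open>1 + card (neighbours u)\<close> is positive.\<close>
  then have "card (fibre u) \<le> 4" by (simp only: mult_le_cancel2)
  then have "(card (fibre u))\<^sup>2 \<le> 4\<^sup>2" by (rule power_mono) simp
  then show ?thesis using card_V_le_fibre[OF u] by simp
qed

end

section \<open>Graph distances as lengths of shortest walks\<close>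

lemma (in wf_digraph) awalk_cost_one: "awalk_cost (\<lambda>_. 1) p = real (length p)"
  by (induct p) auto

lemma (in wf_digraph) graph_dist_le_length:
  assumes "awalk u p v"
  shows "graph_dist G u v \<le> ereal (real (length p))"
  using min_cost_le_walk_cost[OF assms, of "\<lambda>_. 1"] by (simp add: graph_dist_def awalk_cost_one)

text \<open>A finite distance means reachability, and with nonnegative weights on a finite digraph
  some path attains the minimal cost. Hence finite distances are natural numbers.\<close>

lemma (in fin_digraph) graph_dist_attained:
  assumes "graph_dist G u v < \<infinity>"
  shows "\<exists>p. awalk u p v \<and> graph_dist G u v = ereal (real (length p))"
proof -
  have "u \<rightarrow>\<^sup>* v" using assms by (simp only: graph_dist_def \<mu>_reach_conv)
  then show ?thesis
    using min_cost_awalk[of u v "\<lambda>_. 1"] by (auto simp: graph_dist_def awalk_cost_one apath_def)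
qed

text \<open>Each arc is replaced by one in the opposite direction; the symmetry of the distance
  rests on this.\<close>

lemma (in wf_digraph) awalk_reverse:
  assumes "symmetric G" "awalk u p v"
  shows "\<exists>q. awalk v q u \<and> length q = length p"
  using assms(2)
proof (induct p arbitrary: u)
  case Nil
  then show ?case by (auto simp: awalk_Nil_iff)
next
  case (Cons e p)
  then obtain q where q: "awalk v q (head G e)" "length q = length p"
    by (auto simp: awalk_Cons_iff)
  obtain e' where "e' \<in> arcs G" "tail G e' = head G e" "head G e' = tail G e"
    using assms(1) Cons.prems by (auto simp: symmetric_conv awalk_Cons_iff)
  then have "awalk (head G e) [e'] u"
    using Cons.prems by (auto simp: awalk_simps)
  with q show ?case by (intro exI[of _ "q @ [e']"]) (auto simp: awalk_appendI simp del: awalk_append_iff)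
qed

lemma graph_dist_le_diameter:
  assumes "u \<in> verts X" "v \<in> verts X"
  shows "graph_dist X u v \<le> graph_diameter X"
  unfolding graph_diameter_def using assms by (meson SUP_upper order_trans)

text \<open>Over a finite nonempty vertex set both nested suprema are maxima. This supplies the pair
  at distance 3.\<close>

lemma graph_diameter_attained:
  assumes "finite (verts X)" "verts X \<noteq> {}"
  shows "\<exists>u\<in>verts X. \<exists>v\<in>verts X. graph_dist X u v = graph_diameter X"
proof -
  have *: "(SUP v\<in>verts X. g v) \<in> g ` verts X" for g :: "'a \<Rightarrow> ereal"
    using assms Max_in[of "g ` verts X"] by (simp add: cSup_eq_Max)
  obtain u where "u \<in> verts X" "graph_diameter X = (SUP v\<in>verts X. graph_dist X u v)"
    using *[of "\<lambda>u. SUP v\<in>verts X. graph_dist X u v"] unfolding graph_diameter_def by blast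
  moreover obtain v where "v \<in> verts X" "(SUP v\<in>verts X. graph_dist X u v) = graph_dist X u v"
    using *[of "graph_dist X u"] by (rule imageE)
  ultimately show ?thesis by metis
qed

lemma antipodal_scheme_graph_dist:
  assumes X: "distance_regular X" "antipodal X" "graph_diameter X = 3"
  obtains d where "antipodal_scheme (verts X) d"
    and "\<And>u v. \<lbrakk>u \<in> verts X; v \<in> verts X\<rbrakk> \<Longrightarrow> graph_dist X u v = ereal (real (d u v))"
proof -
  interpret graph X using X(1) by (simp add: distance_regular_def)
  let ?V = "verts X"
  \<comment> \<open>The choice is meaningful where the distance is finite, which the diameter bound
    ensures for all pairs of vertices.\<close>
  define d where "d u v = (SOME n. graph_dist X u v = ereal (real n))" for u v
  have walk: "\<exists>p. awalk u p v \<and> graph_dist X u v = ereal (real (length p))"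
    if "u \<in> ?V" "v \<in> ?V" for u v
  proof (rule graph_dist_attained)
    have "graph_dist X u v \<le> 3" using graph_dist_le_diameter[OF that] X(3) by simp
    then show "graph_dist X u v < \<infinity>" by auto
  qed
  have d: "graph_dist X u v = ereal (real (d u v))" if "u \<in> ?V" "v \<in> ?V" for u v
    unfolding d_def by (rule someI_ex) (use walk[OF that] in blast)
  have dwalk: "\<exists>p. awalk u p v \<and> length p = d u v" if "u \<in> ?V" "v \<in> ?V" for u v
    using walk[OF that] d[OF that] by auto
  have dle: "d u v \<le> length p" if "awalk u p v" for u p v
  proof -
    have "u \<in> ?V" "v \<in> ?V" using that by auto
    with graph_dist_le_length[OF that] d show ?thesis by simp
  qed
  have sym_le: "d u v \<le> d v u" if V: "u \<in> ?V" "v \<in> ?V" for u v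
    using dwalk[OF V(2,1)] awalk_reverse[OF sym_arcs] dle by metis
  have tri: "d u w \<le> d u v + d v w" if V: "u \<in> ?V" "v \<in> ?V" "w \<in> ?V" for u v w
  proof -
    obtain p q where "awalk u p v" "length p = d u v" "awalk v q w" "length q = d v w"
      using dwalk V by meson
    then show ?thesis using dle[OF awalk_appendI[of u p v q w]] by simp
  qed
  have zero: "d u v = 0 \<longleftrightarrow> u = v" if V: "u \<in> ?V" "v \<in> ?V" for u v
    using dwalk[OF V] dle[of u "[]" v] V by (auto simp: awalk_Nil_iff)
  have three: "graph_dist X u v = 3 \<longleftrightarrow> d u v = 3" if V: "u \<in> ?V" "v \<in> ?V" for u v
    using d[OF V] by simp
  \<comment> \<open>A supremum over no vertices is minus infinity, so the diameter 3 excludes the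
    empty graph.\<close>
  have "?V \<noteq> {}" using X(3) by (auto simp: graph_diameter_def bot_ereal_def)
  then obtain a b where ab: "a \<in> ?V" "b \<in> ?V" "d a b = 3"
    using graph_diameter_attained[OF finite_verts] X(3) three by metis
  have "antipodal_scheme ?V d"
  proof
    show "finite ?V" by simp
    show "d u v \<le> 3" if "u \<in> ?V" "v \<in> ?V" for u v
      using graph_dist_le_diameter[OF that] X(3) d[OF that] by simp
    show "d u v = 0 \<longleftrightarrow> u = v" if "u \<in> ?V" "v \<in> ?V" for u v by (rule zero[OF that])
    show "d u v = d v u" if "u \<in> ?V" "v \<in> ?V" for u v
      using sym_le that by (simp add: antisym)
    show "d u w \<le> d u v + d v w" if "u \<in> ?V" "v \<in> ?V" "w \<in> ?V" for u v w
      by (rule tri[OF that])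
    show "\<exists>w\<in>?V. d u w = 1 \<and> d w v = n" if V: "u \<in> ?V" "v \<in> ?V" "d u v = Suc n" for u v n
    proof -
      obtain p where "awalk u p v" "length p = Suc n" using dwalk V by metis
      then obtain e q where e: "e \<in> arcs X" "u = tail X e" "awalk (head X e) q v" "length q = n"
        by (cases p) (auto simp: awalk_Cons_iff)
      \<comment> \<open>The first arc of a shortest walk gives only upper bounds; the triangle
        inequality with \<open>d u v = Suc n\<close> turns both into equalities.\<close>
      then have "d u (head X e) \<le> 1" "d (head X e) v \<le> n" "head X e \<in> ?V"
        using dle[OF arc_implies_awalk[OF e(1)]] dle[OF e(3)] by auto
      then show ?thesis using tri[of u "head X e" v] V by (intro bexI[of _ "head X e"]) auto
    qed
    show "d u w = 3"
      if V: "u \<in> ?V" "v \<in> ?V" "w \<in> ?V" "d u v = 3" "d v w = 3" "u \<noteq> w" for u v w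
    proof -
      \<comment> \<open>\<open>R\<close> is the antipodality relation with the diameter replaced by
        its value 3; distance 0 is then ruled out by \<open>u \<noteq> w\<close>.\<close>
      define R where "R = {(u, v). u \<in> ?V \<and> v \<in> ?V \<and> (graph_dist X u v = 0 \<or> graph_dist X u v = 3)}"
      have "trans R" using X(2,3) by (auto simp: antipodal_def R_def equiv_def)
      moreover have "(u, v) \<in> R" "(v, w) \<in> R" using V three by (auto simp: R_def)
      ultimately have "(u, w) \<in> R" by (meson transE)
      then show ?thesis using V three zero[of u w] d[of u w] by (auto simp: R_def)
    qed
    show "card {w \<in> ?V. d u w = i \<and> d v w = j} = card {w \<in> ?V. d u' w = i \<and> d v' w = j}"
      if V: "u \<in> ?V" "v \<in> ?V" "u' \<in> ?V" "v' \<in> ?V" "d u v = d u' v'" for u v u' v' i j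
    proof -
      have *: "{w \<in> ?V. graph_dist X x w = ereal (real i) \<and> graph_dist X y w = ereal (real j)}
          = {w \<in> ?V. d x w = i \<and> d y w = j}" if "x \<in> ?V" "y \<in> ?V" for x y
        using that by (auto simp: d)
      have "graph_dist X u v = graph_dist X u' v'" using V by (simp add: d)
      then have "card {w \<in> ?V. graph_dist X u w = ereal (real i) \<and> graph_dist X v w = ereal (real j)}
          = card {w \<in> ?V. graph_dist X u' w = ereal (real i) \<and> graph_dist X v' w = ereal (real j)}"
        using X(1) V unfolding distance_regular_def by blast
      then show ?thesis using * V by simp
    qed
    show "\<exists>u\<in>?V. \<exists>v\<in>?V. d u v = 3" using ab by blast
  qed
  then show ?thesis using d that by blast
qed

section \<open>From a matrix in the span to a function of the distance\<close>

lemma card_verts_le_64: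
  assumes X: "distance_regular X" "antipodal X" "graph_diameter X = 3" "span_contains_hadamard X"
  shows "card (verts X) \<le> 64"
proof -
  obtain d where scheme: "antipodal_scheme (verts X) d"
    and d: "\<And>u v. \<lbrakk>u \<in> verts X; v \<in> verts X\<rbrakk> \<Longrightarrow> graph_dist X u v = ereal (real (d u v))"
    using antipodal_scheme_graph_dist[OF X(1-3)] by blast
  interpret antipodal_scheme "verts X" d by (rule scheme)
  obtain vs W where vs: "vertex_enumeration X vs" and WS: "W \<in> distance_span3 X vs"
    and had: "complex_hadamard (card (verts X)) W"
    using X(4) by (auto simp: span_contains_hadamard_def)
  have dist: "distinct vs" and set: "set vs = verts X"
    using vs by (auto simp: vertex_enumeration_def)
  define N where "N = card (verts X)"
  have len: "length vs = N" using distinct_card[OF dist] set by (simp add: N_def)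
  obtain a b c e where W: "W = a \<cdot>\<^sub>m 1\<^sub>m (length vs) + b \<cdot>\<^sub>m distance_matrix X vs 1
        + c \<cdot>\<^sub>m distance_matrix X vs 2 + e \<cdot>\<^sub>m distance_matrix X vs 3"
    using WS by (auto simp: distance_span3_def)
  \<comment> \<open>The coefficient of the distance-\<open>i\<close> matrix, with the identity as
    the case \<open>i = 0\<close>; only the indices 0 to 3 occur as distances.\<close>
  define f :: "nat \<Rightarrow> complex" where "f i = [a, b, c, e] ! i" for i
  have vsV: "vs ! i \<in> verts X" if "i < N" for i using that len set by (metis nth_mem)
  have entry: "W $$ (i, j) = f (d (vs ! i) (vs ! j))" if "i < N" "j < N" for i j
  proof -
    have ij: "vs ! i \<in> verts X" "vs ! j \<in> verts X" using that vsV by auto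
    have "d (vs ! i) (vs ! j) \<in> {0, 1, 2, 3}" using dist_le_3[OF ij] by auto
    \<comment> \<open>Because the enumeration has no repetitions, the identity matrix marks exactly
      the pairs at distance 0.\<close>
    moreover have "d (vs ! i) (vs ! j) = 0 \<longleftrightarrow> i = j"
      using dist_0_iff[OF ij] dist that len by (simp add: nth_eq_iff_index_eq)
    ultimately show ?thesis
      unfolding W distance_matrix_def using that len
      by (auto simp: d[OF ij] f_def)
  qed
  have W_carrier: "W \<in> carrier_mat N N" and mod1: "\<And>i j. \<lbrakk>i < N; j < N\<rbrakk> \<Longrightarrow> cmod (W $$ (i, j)) = 1"
    and WW: "W * transpose_mat (map_mat cnj W) = of_nat N \<cdot>\<^sub>m 1\<^sub>m N"
    using had by (auto simp: complex_hadamard_def N_def)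
  have index: "\<exists>i<N. v = vs ! i" if "v \<in> verts X" for v
    using that set len by (metis in_set_conv_nth)
  have bij: "bij_betw (\<lambda>l. vs ! l) {0..<N} (verts X)"
    using bij_betw_nth[OF dist, of "{0..<N}" "verts X"] len set by (simp add: atLeast0LessThan)
  interpret hadamard_scheme "verts X" d f
  proof
    fix u v assume uv: "u \<in> verts X" "v \<in> verts X"
    obtain i j where ij: "i < N" "j < N" "u = vs ! i" "v = vs ! j" using index uv by metis
    show "cmod (f (d u v)) = 1" using mod1 entry ij by metis
    have "(W * transpose_mat (map_mat cnj W)) $$ (i, j)
        = (\<Sum>l\<in>{0..<N}. W $$ (i, l) * cnj (W $$ (j, l)))"
      using ij W_carrier by (auto simp: scalar_prod_def intro!: sum.cong)
    also have "\<dots> = (\<Sum>l\<in>{0..<N}. f (d u (vs ! l)) * cnj (f (d v (vs ! l))))"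
      using ij by (intro sum.cong) (auto simp: entry)
    also have "\<dots> = (\<Sum>w\<in>verts X. f (d u w) * cnj (f (d v w)))"
      by (rule sum.reindex_bij_betw[OF bij])
    finally have "(\<Sum>w\<in>verts X. f (d u w) * cnj (f (d v w)))
        = (W * transpose_mat (map_mat cnj W)) $$ (i, j)" by (rule sym)
    then show "(\<Sum>w\<in>verts X. f (d u w) * cnj (f (d v w)))
        = (if u = v then of_nat (card (verts X)) else 0)"
      using ij WW dist len by (simp add: nth_eq_iff_index_eq N_def)
  qed
  show ?thesis by (rule card_V_le_64)
qed

section \<open>Finiteness up to isomorphism\<close>

text \<open>Renaming the vertices to natural numbers below \<open>n\<close> and each arc to its pair
  of ends leaves finitely many vertex and arc sets.\<close>

lemma finitely_many_digraphs_up_to_iso: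
  "\<exists>F :: (nat, nat \<times> nat) pre_digraph set. finite F \<and>
    (\<forall>X :: ('a, 'b) pre_digraph. digraph X \<and> card (verts X) \<le> n \<longrightarrow> (\<exists>Y\<in>F. digraph_iso X Y))"
proof -
  define mk :: "nat set \<times> (nat \<times> nat) set \<Rightarrow> (nat, nat \<times> nat) pre_digraph" where
    "mk = (\<lambda>(V, A). \<lparr>verts = V, arcs = A, tail = fst, head = snd\<rparr>)"
  define F where "F = mk ` (Pow {0..<n} \<times> Pow ({0..<n} \<times> {0..<n}))"
  have "\<exists>Y\<in>F. digraph_iso X Y" if X: "digraph X" "card (verts X) \<le> n" for X :: "('a, 'b) pre_digraph"
  proof -
    interpret digraph X by (rule X(1))
    obtain h where h: "bij_betw h (verts X) {0..<card (verts X)}"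
      using ex_bij_betw_finite_nat[OF finite_verts] by blast
    define k where "k e = (h (tail X e), h (head X e))" for e
    define hom where "hom = \<lparr>iso_verts = h, iso_arcs = k, iso_head = snd, iso_tail = fst\<rparr>"
    have inj: "inj_on h (verts X)" using h by (rule bij_betw_imp_inj_on)
    have range: "h v \<in> {0..<n}" if "v \<in> verts X" for v
      using bij_betwE[OF h] that X(2) by fastforce
    \<comment> \<open>An arc is determined by its ends, since there are no parallel arcs, and
      \<open>h\<close> keeps the ends apart.\<close>
    have "inj_on k (arcs X)"
      by (rule inj_onI) (auto simp: k_def arc_to_ends_def inj_on_eq_iff[OF inj] intro!: no_multi_arcs)
    then have "digraph_isomorphism hom"
      using inj wf_digraph by (simp add: digraph_isomorphism_def hom_def k_def)
    then have "digraph_iso X (app_iso hom X)" by (auto simp: digraph_iso_def)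
    moreover have "app_iso hom X = mk (h ` verts X, k ` arcs X)"
      by (simp add: mk_def app_iso_def hom_def)
    moreover have "h ` verts X \<in> Pow {0..<n}" "k ` arcs X \<in> Pow ({0..<n} \<times> {0..<n})"
      using range by (auto simp: k_def)
    ultimately show ?thesis unfolding F_def by blast
  qed
  moreover have "finite F" by (simp add: F_def)
  ultimately show ?thesis by blast
qed

theorem theorem3p4:
  shows "\<exists>F :: (nat, nat \<times> nat) pre_digraph set. finite F \<and>
    (\<forall>X :: ('a, 'b) pre_digraph.
       distance_regular X \<and> antipodal X \<and> graph_diameter X = 3 \<and> span_contains_hadamard X
       \<longrightarrow> (\<exists>Y\<in>F. digraph_iso X Y))"
proof -
  obtain F :: "(nat, nat \<times> nat) pre_digraph set" where "finite F"
    and F: "\<And>X :: ('a, 'b) pre_digraph. digraph X \<Longrightarrow> card (verts X) \<le> 64 \<Longrightarrow> \<exists>Y\<in>F. digraph_iso X Y"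
    using finitely_many_digraphs_up_to_iso[of 64] by blast
  moreover have "digraph X" if "distance_regular X" for X :: "('a, 'b) pre_digraph"
    using that by (auto simp: distance_regular_def graph_def)
  ultimately show ?thesis using card_verts_le_64 by blast
qed

end
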